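(* Let $n\ge 1$, let $A,B\in\mathbb{M}_n$ be Hermitian and let $X,Y\in\mathbb{M}_n$. If $X^*X+Y^*Y=XX^*+YY^*=I$, then there exist unitary matrices $U_1,\dots,U_{2n}\in\mathbb{M}_{2n}$ such that $$ (X^*AX+Y^*BY)\oplus (Y^*AY+X^*BX)=\frac{1}{2n}\sum_{k=1}^{2n}U_k(A\oplus B)U_k^*. $$
   Context: $\mathbb{M}_d$ is the space of $d\times d$ complex matrices and $I$ is the identity of $\mathbb{M}_n$. $S\oplus T$ is the block-diagonal matrix with diagonal blocks $S,T$. *)

theory Defs
  imports Complex_Main "Jordan_Normal_Form.Schur_Decomposition"
begin

definition hermitian_mat :: "complex mat \<Rightarrow> bool" where
  "hermitian_mat A \<longleftrightarrow> mat_adjoint A = A"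

definition unitary_mat :: "complex mat \<Rightarrow> bool" where
  "unitary_mat U \<longleftrightarrow>
     square_mat U \<and> mat_adjoint U * U = 1\<^sub>m (dim_row U) \<and> U * mat_adjoint U = 1\<^sub>m (dim_row U)"

end

theory Submission
  imports Defs "Jordan_Normal_Form.Spectral_Radius"
begin

text \<open>Put \<open>S = A \<oplus> B\<close> and let \<open>T\<close> be the block matrix on the left-hand side. With \<open>K = X \<oplus> X\<close> and
\<open>L\<close> the matrix with off-diagonal blocks \<open>Y\<close> and zero diagonal blocks, one has \<open>T = K^* S K + L^* S L\<close>, and the two
hypotheses on \<open>X\<close> and \<open>Y\<close> become \<open>K^* K + L^* L = 1\<close> and \<open>K K^* + L L^* = 1\<close>. The map taking \<open>S\<close> to \<open>T\<close> is therefore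
unital and trace preserving, so that the eigenvalues of \<open>T\<close> are a doubly stochastic image of those of \<open>S\<close>
and are majorized by them (\<open>two_term_channel_majorizes\<close>).

Majorization of the spectra is all that the conclusion needs. By the existence half of the Schur-Horn theorem
(\<open>schur_horn\<close>) some unitary conjugate of \<open>S\<close> has the eigenvalues of \<open>T\<close> as its diagonal, and the diagonal part of a matrix
of size \<open>d = 2 n\<close> is the average of its \<open>d\<close> conjugates by powers of the diagonal matrix of \<open>d\<close>-th roots of unity
(\<open>majorized_is_unitary_average\<close>); this is where the number \<open>2 n\<close> of unitaries comes from.

The Schur-Horn theorem is split into two parts. A plane rotation moves two diagonal entries of a Hermitian matrix towards each
other by any prescribed amount, up to exchanging them (\<open>exists_pinching_unitary\<close>), and a set of real vectors closed under
such pinches contains everything that its members majorize (\<open>pinch_closed_reaches_majorized\<close>). The second part is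
combinatorial: to reach a prescribed coordinate, pinch the two values that enclose it most tightly, which keeps
the target majorized (\<open>majorizes_pinch_adjacent\<close>), and recurse on the other coordinates.\<close>

section \<open>Majorization and pinching\<close>

text \<open>Majorization in its hinge-function form: for equal totals, comparing the sums of
\<open>max 0 (v - c)\<close> for all thresholds \<open>c\<close> is equivalent to comparing partial sums of the
decreasing rearrangements. This form needs no sorting, and Jensen's inequality gives it directly
for a doubly stochastic image.\<close>

definition majorizes :: "'a set \<Rightarrow> ('a \<Rightarrow> real) \<Rightarrow> ('a \<Rightarrow> real) \<Rightarrow> bool" where
  "majorizes J x y \<longleftrightarrow> sum x J = sum y J \<and>
     (\<forall>c. (\<Sum>i\<in>J. max 0 (y i - c)) \<le> (\<Sum>i\<in>J. max 0 (x i - c)))"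

text \<open>One step moves two coordinates towards each other with their sum fixed. The value \<open>p\<close> may be
an endpoint, so transpositions of coordinates are included.\<close>

definition pinch_closed :: "'a set \<Rightarrow> ('a \<Rightarrow> real) set \<Rightarrow> bool" where
  "pinch_closed J R \<longleftrightarrow> (\<forall>x\<in>R. \<forall>i\<in>J. \<forall>j\<in>J. \<forall>p.
     i \<noteq> j \<longrightarrow> x i \<le> p \<longrightarrow> p \<le> x j \<longrightarrow> x(i := p, j := x i + x j - p) \<in> R)"

lemma sum_fun_upd2:
  fixes f :: "'b \<Rightarrow> real"
  assumes "finite J" "i \<in> J" "j \<in> J" "i \<noteq> j"
  shows "(\<Sum>k\<in>J. f ((x(i := p, j := q)) k)) = (\<Sum>k\<in>J. f (x k)) - f (x i) - f (x j) + f p + f q"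
proof -
  have J: "J = insert i (insert j (J - {i,j}))" using assms by auto
  have "(\<Sum>k\<in>J. f ((x(i := p, j := q)) k)) = f p + (f q + (\<Sum>k\<in>J-{i,j}. f (x k)))"
    using assms by (subst J) (simp add: sum.insert)
  moreover have "(\<Sum>k\<in>J. f (x k)) = f (x i) + (f (x j) + (\<Sum>k\<in>J-{i,j}. f (x k)))"
    using assms by (subst J) (simp add: sum.insert)
  ultimately show ?thesis by simp
qed

text \<open>The hinge inequality at the threshold \<open>Max (x ` J)\<close> excludes a larger \<open>y d\<close>. At \<open>Min (x ` J)\<close> every hinge
of \<open>x\<close> is linear, so with equal totals a smaller \<open>y d\<close> would make the hinge sum of \<open>y\<close> too large.\<close>

lemma majorizes_range:
  assumes J: "finite J" "d \<in> J" and maj: "majorizes J x y"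
  shows "\<exists>k\<in>J. y d \<le> x k" "\<exists>k\<in>J. x k \<le> y d"
proof -
  have hinge: "(\<Sum>i\<in>J. max 0 (y i - c)) \<le> (\<Sum>i\<in>J. max 0 (x i - c))" for c
    using maj by (simp add: majorizes_def)
  have sums: "sum x J = sum y J" using maj by (simp add: majorizes_def)
  have single: "y d - c \<le> (\<Sum>i\<in>J. max 0 (y i - c))" for c
    using member_le_sum[of d J "\<lambda>i. max 0 (y i - c)"] J by auto
  show "\<exists>k\<in>J. y d \<le> x k"
  proof (rule ccontr)
    assume "\<not> ?thesis"
    then have less: "x k < y d" if "k \<in> J" for k using that by force
    have m: "Max (x ` J) \<in> x ` J" using J by (intro Max_in) auto
    have "(\<Sum>i\<in>J. max 0 (x i - Max (x ` J))) = 0"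
      using J by (intro sum.neutral ballI max_absorb1) auto
    with hinge[of "Max (x ` J)"] single[of "Max (x ` J)"] m less show False by fastforce
  qed
  show "\<exists>k\<in>J. x k \<le> y d"
  proof (rule ccontr)
    assume "\<not> ?thesis"
    then have less: "y d < x k" if "k \<in> J" for k using that by force
    define c where "c = Min (x ` J)"
    have m: "c \<in> x ` J" unfolding c_def using J by (intro Min_in) auto
    have cd: "y d < c" using m less by auto
    have "(\<Sum>i\<in>J. max 0 (x i - c)) = (\<Sum>i\<in>J. x i - c)"
      using J by (intro sum.cong) (auto simp: c_def max_def)
    also have "\<dots> = (\<Sum>i\<in>J. y i - c)" using sums by (simp add: sum_subtractf)
    also have "\<dots> < (\<Sum>i\<in>J. max 0 (y i - c))"
      using J cd by (intro sum_strict_mono_ex1) (auto intro!: bexI[of _ d])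
    finally show False using hinge[of c] by simp
  qed
qed

text \<open>Here \<open>x a\<close> and \<open>x b\<close> are neighbours among the values of \<open>x\<close> and enclose \<open>y d\<close>. Pinching them
to \<open>t = y d\<close> and \<open>m = x a + x b - t\<close> changes the hinge sum only at thresholds \<open>c\<close> strictly between
\<open>x b\<close> and \<open>x a\<close>. The set \<open>A\<close> of indices with \<open>x > c\<close> is the same for all such \<open>c\<close>, since no value of \<open>x\<close>
lies in between, so on the whole interval \<open>[x b, x a]\<close> the hinge sum of \<open>x\<close> is affine in the threshold \<open>e\<close> with
slope \<open>- card A\<close>, whereas every index set \<open>C\<close> yields the affine lower bound of slope \<open>- card C\<close> for the
hinge sum of \<open>y\<close>. Cardinalities are integers, so if \<open>C\<close> is smaller than \<open>A\<close>, comparing at the upper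
endpoint gains at least \<open>x a - c\<close>, and if it is larger, comparing at the lower endpoint gains at least
\<open>c - x b\<close>. Either gain suffices, once the index \<open>d\<close> is put into \<open>C\<close> or left out as needed.\<close>

lemma majorizes_pinch_adjacent:
  assumes J: "finite J" "d \<in> J" "a \<in> J" "b \<in> J"
    and maj: "majorizes J x y"
    and between: "x b < y d" "y d < x a"
    and adjacent: "\<And>k. k \<in> J \<Longrightarrow> x k \<le> x b \<or> x a \<le> x k"
  shows "majorizes J (x(b := x a + x b - y d, a := y d)) y"
proof -
  define t where "t = y d"
  define m where "m = x a + x b - t"
  define z where "z = x(b := m, a := t)"
  have ab: "a \<noteq> b" using between by auto
  have tm: "x b < t" "t < x a" "x b < m" "m < x a" using between by (auto simp: t_def m_def)
  have zsum: "(\<Sum>k\<in>J. f (z k)) = (\<Sum>k\<in>J. f (x k)) - f (x a) - f (x b) + f t + f m" for f :: "real \<Rightarrow> real"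
    unfolding z_def using J ab by (subst sum_fun_upd2) auto
  have hinge: "(\<Sum>i\<in>J. max 0 (y i - c)) \<le> (\<Sum>i\<in>J. max 0 (x i - c))" for c
    using maj by (simp add: majorizes_def)
  have goal: "(\<Sum>i\<in>J. max 0 (y i - c)) \<le> (\<Sum>i\<in>J. max 0 (z i - c))" for c
  proof (cases "x b < c \<and> c < x a")
    case False
    then have "max 0 (x a - c) + max 0 (x b - c) = max 0 (t - c) + max 0 (m - c)"
      using tm by (auto simp: m_def max_def)
    then show ?thesis using hinge[of c] zsum[of "\<lambda>v. max 0 (v - c)"] by simp
  next
    case True
    define A where "A = {k\<in>J. c < x k}"
    define B where "B = {i\<in>J. c < y i}"
    have fin: "finite A" "finite B" using J by (auto simp: A_def B_def)
    have A: "(\<Sum>i\<in>J. max 0 (x i - e)) = (\<Sum>i\<in>A. x i - e)" if "x b \<le> e" "e \<le> x a" for e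
    proof -
      have "(\<Sum>i\<in>A. x i - e) = (\<Sum>i\<in>A. max 0 (x i - e))"
        using adjacent True that by (intro sum.cong) (force simp: A_def)+
      also have "\<dots> = (\<Sum>i\<in>J. max 0 (x i - e))"
        using adjacent True that J by (intro sum.mono_neutral_left) (force simp: A_def)+
      finally show ?thesis by simp
    qed
    have any: "(\<Sum>i\<in>C. y i - c) + card C * (c - e) \<le> (\<Sum>i\<in>A. x i - c) + card A * (c - e)"
      if C: "C \<subseteq> J" and e: "x b \<le> e" "e \<le> x a" for C e
    proof -
      have "(\<Sum>i\<in>C. y i - c) + card C * (c - e) = (\<Sum>i\<in>C. y i - e)"
        by (simp add: sum_subtractf algebra_simps)
      also have "\<dots> \<le> (\<Sum>i\<in>C. max 0 (y i - e))" by (intro sum_mono) auto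
      also have "\<dots> \<le> (\<Sum>i\<in>J. max 0 (y i - e))" using C J by (intro sum_mono2) auto
      also have "\<dots> \<le> (\<Sum>i\<in>A. x i - e)" using hinge[of e] A[OF e] by simp
      also have "\<dots> = (\<Sum>i\<in>A. x i - c) + card A * (c - e)"
        by (simp add: sum_subtractf algebra_simps)
      finally show ?thesis .
    qed
    \<comment> \<open>The two gains, from the upper endpoint \<open>e = x a\<close> and from the lower endpoint \<open>e = x b\<close>.\<close>
    have few: "(\<Sum>i\<in>C. y i - c) \<le> (\<Sum>i\<in>A. x i - c) - (x a - c)"
      if C: "C \<subseteq> J" and card: "card C < card A" for C
    proof -
      have "1 * (x a - c) \<le> (real (card A) - real (card C)) * (x a - c)"
        using card True by (intro mult_right_mono) auto
      then show ?thesis using any[OF C, of "x a"] True by (simp add: algebra_simps)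
    qed
    have many: "(\<Sum>i\<in>C. y i - c) \<le> (\<Sum>i\<in>A. x i - c) - (c - x b)"
      if C: "C \<subseteq> J" and card: "card A < card C" for C
    proof -
      have "1 * (c - x b) \<le> (real (card C) - real (card A)) * (c - x b)"
        using card True by (intro mult_right_mono) auto
      then show ?thesis using any[OF C, of "x b"] True by (simp add: algebra_simps)
    qed
    have yB: "(\<Sum>i\<in>J. max 0 (y i - c)) = (\<Sum>i\<in>B. y i - c)"
    proof -
      have "(\<Sum>i\<in>B. y i - c) = (\<Sum>i\<in>B. max 0 (y i - c))"
        by (intro sum.cong) (auto simp: B_def)
      also have "\<dots> = (\<Sum>i\<in>J. max 0 (y i - c))"
        using J by (intro sum.mono_neutral_left) (auto simp: B_def)
      finally show ?thesis by simp
    qed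
    have zA: "(\<Sum>i\<in>J. max 0 (z i - c)) = (\<Sum>i\<in>A. x i - c) - (x a - c) + max 0 (t - c) + max 0 (m - c)"
      using zsum[of "\<lambda>v. max 0 (v - c)"] A[of c] True by simp
    have "(\<Sum>i\<in>B. y i - c) \<le> (\<Sum>i\<in>A. x i - c) - (x a - c) + max 0 (t - c) + max 0 (m - c)"
    proof (cases "c < t")
      case tc: True
      \<comment> \<open>Either the set without \<open>d\<close> is smaller than \<open>A\<close>, or the set with \<open>d\<close> is larger.\<close>
      have dB: "d \<in> B" using tc J by (simp add: B_def t_def)
      show ?thesis
      proof (cases "card (B - {d}) < card A")
        case True
        have "(\<Sum>i\<in>B. y i - c) = (t - c) + (\<Sum>i\<in>B - {d}. y i - c)"
          using dB fin by (subst sum.remove[of _ d]) (auto simp: t_def)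
        then show ?thesis using few[OF _ True] tc by (force simp: B_def)
      next
        case False
        then have "card A < card B" using card_Diff1_less[OF fin(2) dB] by linarith
        from many[OF _ this] show ?thesis using tc by (auto simp: B_def m_def max_def)
      qed
    next
      case tc: False
      have dB: "d \<notin> B" using tc by (simp add: B_def t_def)
      show ?thesis
      proof (cases "card B < card A")
        case True
        from few[OF _ True] show ?thesis by (auto simp: B_def max_def)
      next
        case False
        then have *: "card A < card (insert d B)" using dB fin by simp
        have "(\<Sum>i\<in>insert d B. y i - c) = (t - c) + (\<Sum>i\<in>B. y i - c)"
          using dB fin by (simp add: t_def)
        then show ?thesis using many[OF _ *] J tc by (force simp: B_def m_def max_def)
      qed
    qed
    then show ?thesis using yB zA by simp
  qed
  have "sum z J = sum y J"
    using zsum[of "\<lambda>v. v"] maj by (simp add: majorizes_def m_def)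
  with goal show ?thesis unfolding majorizes_def z_def m_def t_def by simp
qed

text \<open>If \<open>y d\<close> is not yet a value of the vector, pinching the values next above and next below it
makes it one; \<open>majorizes_range\<close> provides both neighbours.\<close>

lemma majorizes_pinch_to_value:
  assumes J: "finite J" "d \<in> J" and maj: "majorizes J x y"
    and R: "pinch_closed J R" "x \<in> R"
  shows "\<exists>z\<in>R. majorizes J z y \<and> (\<exists>a\<in>J. z a = y d)"
proof (cases "\<exists>a\<in>J. x a = y d")
  case True
  with maj R show ?thesis by blast
next
  case False
  define H where "H = {k\<in>J. y d \<le> x k}"
  define L where "L = {k\<in>J. x k \<le> y d}"
  have HL: "finite H" "H \<noteq> {}" "finite L" "L \<noteq> {}"
    using majorizes_range[OF J maj] J by (auto simp: H_def L_def)
  have "Min (x ` H) \<in> x ` H" "Max (x ` L) \<in> x ` L" using HL by (auto intro!: Min_in Max_in)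
  then obtain a b where "a \<in> H" "x a = Min (x ` H)" "b \<in> L" "x b = Max (x ` L)" by force
  then have a: "a \<in> H" "\<And>k. k \<in> H \<Longrightarrow> x a \<le> x k"
    and b: "b \<in> L" "\<And>k. k \<in> L \<Longrightarrow> x k \<le> x b" using HL by auto
  have aJ: "a \<in> J" "b \<in> J" "x b < y d" "y d < x a"
    using a(1) b(1) False by (force simp: H_def L_def)+
  have "x k \<le> x b \<or> x a \<le> x k" if "k \<in> J" for k
    using a(2)[of k] b(2)[of k] that linear[of "y d" "x k"] by (auto simp: H_def L_def)
  then have "majorizes J (x(b := x a + x b - y d, a := y d)) y"
    using aJ by (intro majorizes_pinch_adjacent[OF J aJ(1,2) maj]) auto
  moreover have "x(b := x a + x b - y d, a := x b + x a - (x a + x b - y d)) \<in> R"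
    by (rule R(1)[unfolded pinch_closed_def, rule_format]) (use R aJ in auto)
  ultimately show ?thesis using aJ by (intro bexI[of _ "x(b := x a + x b - y d, a := y d)"]) auto
qed

lemma pinch_closed_swap:
  assumes "pinch_closed J R" "x \<in> R" "i \<in> J" "j \<in> J"
  shows "x(i := x j, j := x i) \<in> R"
proof (cases "i = j")
  case False
  show ?thesis
  proof (cases "x i \<le> x j")
    case True
    then have "x(i := x j, j := x i + x j - x j) \<in> R"
      using assms False unfolding pinch_closed_def by blast
    then show ?thesis by simp
  next
    case less: False
    then have "x(j := x i, i := x j + x i - x i) \<in> R"
      using assms False unfolding pinch_closed_def by (metis linear)
    then show ?thesis using False by (simp add: fun_upd_twist)
  qed
qed (use assms in auto)

text \<open>Induction on the number of coordinates: once \<open>y d\<close> occurs among the values, it is transposed into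
coordinate \<open>d\<close>. Equal summands cancel in the hinge sums, so majorization persists on the other coordinates,
and freezing coordinate \<open>d\<close> keeps \<open>R\<close> closed under pinches of them.\<close>

theorem pinch_closed_reaches_majorized:
  assumes "finite J" "majorizes J x y" "pinch_closed J R" "x \<in> R"
  shows "\<exists>z\<in>R. \<forall>j\<in>J. z j = y j"
  using assms
proof (induction J arbitrary: R x rule: finite_induct)
  case empty
  then show ?case by auto
next
  case (insert d J)
  let ?J = "insert d J"
  obtain z a where z: "z \<in> R" "majorizes ?J z y" "a \<in> ?J" "z a = y d"
    using majorizes_pinch_to_value[of ?J d x y R] insert by auto
  define w where "w = z(a := z d, d := z a)"
  have wR: "w \<in> R" unfolding w_def using insert.prems(2) z by (intro pinch_closed_swap) auto
  have wd: "w d = y d" using z by (simp add: w_def)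
  have wsum: "(\<Sum>k\<in>?J. f (w k)) = (\<Sum>k\<in>?J. f (z k))" for f :: "real \<Rightarrow> real"
  proof (cases "a = d")
    case False
    then show ?thesis unfolding w_def using z insert.hyps by (subst sum_fun_upd2) auto
  qed (simp add: w_def)
  have wsum': "(\<Sum>k\<in>J. f (w k)) = (\<Sum>k\<in>?J. f (z k)) - f (y d)" for f :: "real \<Rightarrow> real"
    using wsum[of f] insert.hyps wd by simp
  have "(\<Sum>i\<in>J. max 0 (y i - c)) \<le> (\<Sum>i\<in>J. max 0 (w i - c))" for c
  proof -
    have "(\<Sum>i\<in>?J. max 0 (y i - c)) \<le> (\<Sum>i\<in>?J. max 0 (z i - c))"
      using z(2) by (simp add: majorizes_def)
    then show ?thesis
      using insert.hyps wsum'[of "\<lambda>v. max 0 (v - c)"] by simp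
  qed
  moreover have "sum w J = sum y J"
    using z(2) insert.hyps wsum'[of "\<lambda>v. v"] by (simp add: majorizes_def)
  ultimately have "majorizes J w y" by (simp add: majorizes_def)
  moreover have "pinch_closed J (R \<inter> {u. u d = y d})"
    using insert.prems(2) insert.hyps unfolding pinch_closed_def by auto
  ultimately obtain u where "u \<in> R" "u d = y d" "\<forall>j\<in>J. u j = y j"
    using insert.IH[of w "R \<inter> {u. u d = y d}"] wR wd by auto
  then show ?case by auto
qed

text \<open>Jensen's inequality for the convex function \<open>max 0 (v - c)\<close> along each row, then summation along
the columns.\<close>

lemma doubly_stochastic_majorizes:
  fixes P :: "'a \<Rightarrow> 'a \<Rightarrow> real"
  assumes J: "finite J"
    and nonneg: "\<And>i j. i \<in> J \<Longrightarrow> j \<in> J \<Longrightarrow> 0 \<le> P i j"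
    and rows: "\<And>i. i \<in> J \<Longrightarrow> (\<Sum>j\<in>J. P i j) = 1"
    and cols: "\<And>j. j \<in> J \<Longrightarrow> (\<Sum>i\<in>J. P i j) = 1"
    and y: "\<And>i. i \<in> J \<Longrightarrow> y i = (\<Sum>j\<in>J. P i j * x j)"
  shows "majorizes J x y"
proof -
  have swap: "(\<Sum>i\<in>J. \<Sum>j\<in>J. P i j * f j) = sum f J" for f :: "'a \<Rightarrow> real"
    using cols by (subst sum.swap) (simp add: sum_distrib_right[symmetric])
  have "(\<Sum>i\<in>J. max 0 (y i - c)) \<le> (\<Sum>i\<in>J. max 0 (x i - c))" for c
  proof -
    have "max 0 (y i - c) \<le> (\<Sum>j\<in>J. P i j * max 0 (x j - c))" if i: "i \<in> J" for i
    proof -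
      have "y i - c = (\<Sum>j\<in>J. P i j * (x j - c))"
        using y[OF i] rows[OF i] by (simp add: right_diff_distrib sum_subtractf sum_distrib_right[symmetric])
      also have "\<dots> \<le> (\<Sum>j\<in>J. P i j * max 0 (x j - c))"
        using nonneg[OF i] by (intro sum_mono mult_left_mono) auto
      finally show ?thesis using nonneg[OF i] by (auto intro!: sum_nonneg)
    qed
    then have "(\<Sum>i\<in>J. max 0 (y i - c)) \<le> (\<Sum>i\<in>J. \<Sum>j\<in>J. P i j * max 0 (x j - c))"
      by (intro sum_mono)
    then show ?thesis by (simp add: swap)
  qed
  moreover have "sum x J = sum y J" using y swap[of x] by simp
  ultimately show ?thesis by (simp add: majorizes_def)
qed

section \<open>Adjoints, unitary matrices and the spectral theorem\<close>

lemma dim_mat_adjoint [simp]: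
  "dim_row (mat_adjoint A) = dim_col A" "dim_col (mat_adjoint A) = dim_row A"
  by (simp_all add: mat_adjoint_def)

lemma mat_adjoint_carrier [simp]:
  "A \<in> carrier_mat n m \<Longrightarrow> mat_adjoint A \<in> carrier_mat m n"
  by (intro carrier_matI) auto

lemma index_mat_adjoint [simp]:
  fixes A :: "complex mat"
  shows "i < dim_col A \<Longrightarrow> j < dim_row A \<Longrightarrow> mat_adjoint A $$ (i, j) = cnj (A $$ (j, i))"
  by (simp add: mat_adjoint_def mat_of_rows_def)

lemma mat_adjoint_adjoint [simp]: "mat_adjoint (mat_adjoint A) = (A :: complex mat)"
  by (rule eq_matI) auto

lemma index_mult_mat_sum:
  assumes "A \<in> carrier_mat n m" "B \<in> carrier_mat m k" "i < n" "j < k"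
  shows "(A * B) $$ (i, j) = (\<Sum>l<m. A $$ (i, l) * B $$ (l, j))"
  using assms by (auto simp: scalar_prod_def atLeast0LessThan intro!: sum.cong)

lemma mat_adjoint_mult:
  fixes A B :: "complex mat"
  assumes "A \<in> carrier_mat n m" "B \<in> carrier_mat m k"
  shows "mat_adjoint (A * B) = mat_adjoint B * mat_adjoint A"
proof (rule eq_matI)
  fix i j assume "i < dim_row (mat_adjoint B * mat_adjoint A)" "j < dim_col (mat_adjoint B * mat_adjoint A)"
  then have ij: "i < k" "j < n" using assms by auto
  have "mat_adjoint (A * B) $$ (i, j) = cnj ((A * B) $$ (j, i))"
    using assms ij by (intro index_mat_adjoint) auto
  also have "\<dots> = (\<Sum>l<m. cnj (A $$ (j, l)) * cnj (B $$ (l, i)))"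
    unfolding index_mult_mat_sum[OF assms ij(2,1)] by simp
  also have "\<dots> = (mat_adjoint B * mat_adjoint A) $$ (i, j)"
    using assms ij by (subst index_mult_mat_sum[of _ k m _ n]) (auto intro!: sum.cong)
  finally show "mat_adjoint (A * B) $$ (i, j) = (mat_adjoint B * mat_adjoint A) $$ (i, j)" .
qed (use assms in auto)

lemma mat_adjoint_add:
  fixes A B :: "complex mat"
  assumes "A \<in> carrier_mat n m" "B \<in> carrier_mat n m"
  shows "mat_adjoint (A + B) = mat_adjoint A + mat_adjoint B"
  using assms by (intro eq_matI) auto

lemma mat_adjoint_four_block:
  fixes A B C D :: "complex mat"
  assumes "A \<in> carrier_mat n1 m1" "B \<in> carrier_mat n1 m2" "C \<in> carrier_mat n2 m1" "D \<in> carrier_mat n2 m2"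
  shows "mat_adjoint (four_block_mat A B C D) =
    four_block_mat (mat_adjoint A) (mat_adjoint C) (mat_adjoint B) (mat_adjoint D)"
  using assms by (intro eq_matI) auto

lemma mat_adjoint_zero [simp]: "mat_adjoint (0\<^sub>m n m :: complex mat) = 0\<^sub>m m n"
  by (rule eq_matI) auto

lemma mat_adjoint_one [simp]: "mat_adjoint (1\<^sub>m n :: complex mat) = 1\<^sub>m n"
  by (rule eq_matI) auto

lemma index_conjugation:
  fixes Q G :: "complex mat"
  assumes "Q \<in> carrier_mat n m" "G \<in> carrier_mat m m" "i < n" "j < n"
  shows "(Q * G * mat_adjoint Q) $$ (i, j) =
    (\<Sum>a<m. Q $$ (i, a) * (\<Sum>b<m. G $$ (a, b) * cnj (Q $$ (j, b))))"
proof -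
  have "Q * G * mat_adjoint Q = Q * (G * mat_adjoint Q)"
    using assms by (intro assoc_mult_mat) auto
  also have "\<dots> $$ (i, j) = (\<Sum>a<m. Q $$ (i, a) * (G * mat_adjoint Q) $$ (a, j))"
    using assms by (intro index_mult_mat_sum) auto
  also have "\<dots> = (\<Sum>a<m. Q $$ (i, a) * (\<Sum>b<m. G $$ (a, b) * cnj (Q $$ (j, b))))"
    using assms
    by (intro sum.cong refl arg_cong2[where f = "(*)"])
       (subst index_mult_mat_sum[of _ m m _ n], auto intro!: sum.cong)
  finally show ?thesis .
qed

lemma mult_carrier_mat_square [simp]:
  "A \<in> carrier_mat n n \<Longrightarrow> B \<in> carrier_mat n n \<Longrightarrow> A * B \<in> carrier_mat n n"
  by (rule mult_carrier_mat)

lemma hermitian_conjugation: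
  assumes "Q \<in> carrier_mat n n" "G \<in> carrier_mat n n" "hermitian_mat G"
  shows "hermitian_mat (Q * G * mat_adjoint Q)"
  using assms unfolding hermitian_mat_def
  by (simp add: mat_adjoint_mult[of _ n n _ n] assoc_mult_mat[of _ n n _ n _ n])

lemma unitary_matI:
  assumes "U \<in> carrier_mat n n" "mat_adjoint U * U = 1\<^sub>m n"
  shows "unitary_mat U"
  using assms mat_mult_left_right_inverse[of "mat_adjoint U" n U]
  by (auto simp: unitary_mat_def)

lemma unitary_matD:
  assumes "U \<in> carrier_mat n n" "unitary_mat U"
  shows "mat_adjoint U * U = 1\<^sub>m n" "U * mat_adjoint U = 1\<^sub>m n"
  using assms by (auto simp: unitary_mat_def)

lemma unitary_mat_adjoint:
  assumes "U \<in> carrier_mat n n" "unitary_mat U"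
  shows "unitary_mat (mat_adjoint U)"
  using assms by (intro unitary_matI[of _ n]) (auto simp: unitary_matD)

lemma mult_mat_cancel_inner:
  fixes A B C D :: "'a :: comm_ring_1 mat"
  assumes "A \<in> carrier_mat n n" "B \<in> carrier_mat n n" "C \<in> carrier_mat n n" "D \<in> carrier_mat n n"
    and "B * C = 1\<^sub>m n"
  shows "A * B * (C * D) = A * D"
proof -
  have "A * B * (C * D) = A * (B * C * D)"
    using assms(1-4) by (simp add: assoc_mult_mat[of _ n n _ n _ n])
  then show ?thesis using assms by simp
qed

lemma unitary_mat_mult:
  assumes "U \<in> carrier_mat n n" "unitary_mat U" "V \<in> carrier_mat n n" "unitary_mat V"
  shows "unitary_mat (U * V)"
  using assms
  by (intro unitary_matI[of _ n])
     (simp_all add: mat_adjoint_mult[of _ n n _ n] unitary_matD mult_mat_cancel_inner[of _ n])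

lemma conjugation_mult:
  fixes U V G :: "complex mat"
  assumes "U \<in> carrier_mat n n" "V \<in> carrier_mat n n" "G \<in> carrier_mat n n"
  shows "(U * V) * G * mat_adjoint (U * V) = U * (V * G * mat_adjoint V) * mat_adjoint U"
  using assms by (simp add: mat_adjoint_mult[of _ n n _ n] assoc_mult_mat[of _ n n _ n _ n])

lemma unitary_conjugation_inverse:
  assumes "U \<in> carrier_mat n n" "unitary_mat U" "G \<in> carrier_mat n n"
  shows "U * (mat_adjoint U * G * U) * mat_adjoint U = G"
proof -
  have "U * (mat_adjoint U * G * U) * mat_adjoint U = (U * mat_adjoint U) * G * (U * mat_adjoint U)"
    using assms(1,3) by (simp add: assoc_mult_mat[of _ n n _ n _ n])
  then show ?thesis using assms by (simp add: unitary_matD[OF assms(1,2)])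
qed

text \<open>Gram-Schmidt applied to a basis starting with \<open>v\<close>, with the resulting orthogonal vectors normalized.\<close>

lemma exists_unitary_with_first_column:
  fixes v :: "complex vec"
  assumes v: "v \<in> carrier_vec n" "v \<noteq> 0\<^sub>v n"
  shows "\<exists>W c. W \<in> carrier_mat n n \<and> unitary_mat W \<and> (\<forall>i<n. W $$ (i, 0) = c * v $ i)"
proof -
  interpret cof_vec_space n "TYPE(complex)" .
  have n: "0 < n" using v by (cases n) auto
  define ws where "ws = gram_schmidt n (basis_completion v)"
  note bc = basis_completion[OF v]
  obtain vs where "basis_completion v = v # vs"
    using bc(6,7) n by (cases "basis_completion v") auto
  then have hd: "hd ws = v" unfolding ws_def using gram_schmidt_hd[OF v(1)] by simp
  note gs = gram_schmidt_result[OF bc(2,4,5) ws_def]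
  have len: "length ws = n" using gs(4) bc(6) by simp
  have ws0: "ws ! 0 = v" using hd len n by (cases ws) auto
  have carr: "ws ! j \<in> carrier_vec n" if "j < n" for j using gs(3) len that by (metis nth_mem subsetD)
  have inner: "(ws ! i) \<bullet>c (ws ! j) = (\<Sum>l<n. ws ! i $ l * cnj (ws ! j $ l))" if "i < n" "j < n" for i j
    using carr[OF that(1)] carr[OF that(2)]
    by (auto simp: scalar_prod_def atLeast0LessThan intro!: sum.cong)
  define N where "N j = (\<Sum>l<n. (cmod (ws ! j $ l))\<^sup>2)" for j
  have self: "(ws ! j) \<bullet>c (ws ! j) = complex_of_real (N j)" if "j < n" for j
    unfolding inner[OF that that] N_def of_real_sum complex_norm_square ..
  have N: "0 < N j" if "j < n" for j
  proof -
    have "(ws ! j) \<bullet>c (ws ! j) \<noteq> 0" using corthogonalD[OF gs(2)] len that by auto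
    moreover have "0 \<le> N j" unfolding N_def by (intro sum_nonneg) auto
    ultimately show ?thesis using self[OF that] by (auto simp: less_le)
  qed
  define W where "W = mat n n (\<lambda>(i, j). ws ! j $ i / complex_of_real (sqrt (N j)))"
  have W: "W \<in> carrier_mat n n" by (simp add: W_def)
  have "mat_adjoint W * W = 1\<^sub>m n"
  proof (rule eq_matI)
    fix i j assume "i < dim_row (1\<^sub>m n :: complex mat)" "j < dim_col (1\<^sub>m n :: complex mat)"
    then have ij: "i < n" "j < n" by auto
    have "(mat_adjoint W * W) $$ (i, j) =
      (\<Sum>l<n. cnj (ws ! i $ l / complex_of_real (sqrt (N i))) * (ws ! j $ l / complex_of_real (sqrt (N j))))"
      using W ij by (subst index_mult_mat_sum[of _ n n _ n]) (auto simp: W_def)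
    also have "\<dots> = ((ws ! j) \<bullet>c (ws ! i)) / complex_of_real (sqrt (N i) * sqrt (N j))"
      unfolding inner[OF ij(2,1)] sum_divide_distrib by (intro sum.cong) (auto simp: mult_ac)
    also have "\<dots> = 1\<^sub>m n $$ (i, j)"
    proof (cases "i = j")
      case True
      then show ?thesis using ij N[of j] self[of j] by (simp del: of_real_mult)
    next
      case False
      then have "(ws ! j) \<bullet>c (ws ! i) = 0" using corthogonalD[OF gs(2)] len ij by auto
      then show ?thesis using False ij by simp
    qed
    finally show "(mat_adjoint W * W) $$ (i, j) = 1\<^sub>m n $$ (i, j)" .
  qed (use W in auto)
  then have "unitary_mat W" using W by (intro unitary_matI)
  moreover have "\<forall>i<n. W $$ (i, 0) = (1 / complex_of_real (sqrt (N 0))) * v $ i"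
    using n ws0 by (auto simp: W_def)
  ultimately show ?thesis using W by blast
qed

lemma hermitian_index_cnj:
  assumes "hermitian_mat A" "A \<in> carrier_mat n n" "i < n" "j < n"
  shows "A $$ (j, i) = cnj (A $$ (i, j))"
proof -
  have "A $$ (j, i) = mat_adjoint A $$ (j, i)" using assms(1) by (simp add: hermitian_mat_def)
  also have "\<dots> = cnj (A $$ (i, j))" using assms(2-4) by (intro index_mat_adjoint) auto
  finally show ?thesis .
qed

text \<open>The spectral theorem. An eigenvector is made the first basis vector of a unitary change of basis; the
first column of the transformed matrix is then a multiple of the first unit vector, by symmetry the first row is
as well, and induction applies to the remaining block.\<close>

theorem hermitian_diagonalization:
  assumes "A \<in> carrier_mat n n" "hermitian_mat A"
  shows "\<exists>U (f :: nat \<Rightarrow> real). U \<in> carrier_mat n n \<and> unitary_mat U \<and>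
    A = U * mat_diag n (\<lambda>i. complex_of_real (f i)) * mat_adjoint U"
  using assms
proof (induction n arbitrary: A)
  case 0
  then show ?case
  proof (intro exI conjI)
    show "unitary_mat (1\<^sub>m 0)" by (rule unitary_matI[of _ 0]) auto
    show "A = 1\<^sub>m 0 * mat_diag 0 (\<lambda>i. complex_of_real 0) * mat_adjoint (1\<^sub>m 0)"
      using 0 by (intro eq_matI) auto
  qed simp
next
  case (Suc n)
  note A = Suc.prems
  obtain e v where "eigenvector A v e"
    using spectrum_non_empty[OF A(1)] by (auto simp: spectrum_def eigenvalue_def)
  then have v: "v \<in> carrier_vec (Suc n)" "v \<noteq> 0\<^sub>v (Suc n)" and ev: "A *\<^sub>v v = e \<cdot>\<^sub>v v"
    using A by (auto simp: eigenvector_def)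
  obtain W c where W: "W \<in> carrier_mat (Suc n) (Suc n)" "unitary_mat W"
    and W0: "\<And>i. i < Suc n \<Longrightarrow> W $$ (i, 0) = c * v $ i"
    using exists_unitary_with_first_column[OF v] by auto
  define A' where "A' = mat_adjoint W * A * W"
  have A': "A' \<in> carrier_mat (Suc n) (Suc n)" using A W by (simp add: A'_def)
  have hA': "hermitian_mat A'"
    using hermitian_conjugation[of "mat_adjoint W" "Suc n" A] A W by (simp add: A'_def)
  have AW: "(A * W) $$ (i, 0) = e * W $$ (i, 0)" if i: "i < Suc n" for i
  proof -
    have "(A * W) $$ (i, 0) = c * (\<Sum>l<Suc n. A $$ (i, l) * v $ l)"
      using A W i W0 unfolding sum_distrib_left
      by (subst index_mult_mat_sum[of _ "Suc n" "Suc n" _ "Suc n"]) (auto intro!: sum.cong simp del: sum.lessThan_Suc)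
    also have "(\<Sum>l<Suc n. A $$ (i, l) * v $ l) = (A *\<^sub>v v) $ i"
      using A v i by (auto simp: scalar_prod_def atLeast0LessThan intro!: sum.cong simp del: sum.lessThan_Suc sum.op_ivl_Suc)
    also have "\<dots> = e * v $ i" using v i by (simp add: ev)
    finally show ?thesis using W0[OF i] by simp
  qed
  have col0: "A' $$ (i, 0) = (if i = 0 then e else 0)" if i: "i < Suc n" for i
  proof -
    have "A' = mat_adjoint W * (A * W)"
      unfolding A'_def using A W by (intro assoc_mult_mat) auto
    then have "A' $$ (i, 0) = (mat_adjoint W * (A * W)) $$ (i, 0)" by simp
    also have "\<dots> = e * (\<Sum>l<Suc n. mat_adjoint W $$ (i, l) * W $$ (l, 0))"
      using A W i AW unfolding sum_distrib_left
      by (subst index_mult_mat_sum[of _ "Suc n" "Suc n" _ "Suc n"])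
         (auto intro!: sum.cong simp del: sum.lessThan_Suc index_mult_mat(1))
    also have "(\<Sum>l<Suc n. mat_adjoint W $$ (i, l) * W $$ (l, 0)) = (mat_adjoint W * W) $$ (i, 0)"
      using W i by (subst index_mult_mat_sum[of _ "Suc n" "Suc n" _ "Suc n"]) auto
    finally show ?thesis using i by (simp add: unitary_matD[OF W])
  qed
  \<comment> \<open>The eigenvalue is a diagonal entry of a Hermitian matrix, hence real.\<close>
  have e: "complex_of_real (Re e) = e"
    using hermitian_index_cnj[OF hA' A', of 0 0] col0[of 0] by (simp add: complex_eq_iff)
  have row0: "A' $$ (0, j) = (if j = 0 then e else 0)" if j: "j < Suc n" for j
    by (cases j) (use hermitian_index_cnj[OF hA' A', of j 0] col0[OF j] j in auto)
  define A3 where "A3 = mat n n (\<lambda>(i, j). A' $$ (Suc i, Suc j))"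
  have A3: "A3 \<in> carrier_mat n n" by (simp add: A3_def)
  have "hermitian_mat A3"
    using hermitian_index_cnj[OF hA' A', symmetric] unfolding hermitian_mat_def
    by (intro eq_matI) (auto simp: A3_def)
  then obtain U f where U: "U \<in> carrier_mat n n" "unitary_mat U"
    and A3eq: "A3 = U * mat_diag n (\<lambda>i. complex_of_real (f i)) * mat_adjoint U"
    using Suc.IH[OF A3] by blast
  define E where "E = mat 1 1 (\<lambda>_. e)"
  define D where "D = mat_diag n (\<lambda>i. complex_of_real (f i))"
  define V where "V = four_block_mat (1\<^sub>m 1) (0\<^sub>m 1 n) (0\<^sub>m n 1) U"
  define g where "g i = (case i of 0 \<Rightarrow> Re e | Suc k \<Rightarrow> f k)" for i
  have E: "E \<in> carrier_mat 1 1" and D: "D \<in> carrier_mat n n" by (simp_all add: E_def D_def)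
  have V: "V \<in> carrier_mat (Suc n) (Suc n)" 
    using four_block_carrier_mat[OF one_carrier_mat[of 1] U(1)] by (simp add: V_def)
  have adjV: "mat_adjoint V = four_block_mat (1\<^sub>m 1) (0\<^sub>m 1 n) (0\<^sub>m n 1) (mat_adjoint U)"
    unfolding V_def using U by (subst mat_adjoint_four_block[of _ 1 1 _ n _ n]) auto
  have one: "four_block_mat (1\<^sub>m 1) (0\<^sub>m 1 n) (0\<^sub>m n 1) (1\<^sub>m n) = (1\<^sub>m (Suc n) :: complex mat)"
    by (rule eq_matI) auto
  have "mat_adjoint V * V = 1\<^sub>m (Suc n)"
    unfolding adjV unfolding V_def using U
    by (subst mult_four_block_mat[of _ 1 1 _ n _ n]) (auto simp: unitary_matD[OF U] one)
  then have uV: "unitary_mat V" using V by (intro unitary_matI)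
  have G: "mat_diag (Suc n) (\<lambda>i. complex_of_real (g i)) = four_block_mat E (0\<^sub>m 1 n) (0\<^sub>m n 1) D"
    by (rule eq_matI) (auto simp: mat_diag_def E_def D_def g_def e split: nat.splits)
  have "V * mat_diag (Suc n) (\<lambda>i. complex_of_real (g i)) * mat_adjoint V =
      four_block_mat E (0\<^sub>m 1 n) (0\<^sub>m n 1) (U * D * mat_adjoint U)"
    unfolding G adjV unfolding V_def using U E D
    by (simp add: mult_four_block_mat[of _ 1 1 _ n _ n _ _ 1 _ n])
  also have "\<dots> = A'"
    using A' A3 col0 row0
    unfolding A3eq[folded D_def, symmetric]
    by (intro eq_matI) (auto simp: E_def A3_def)
  finally have eq: "V * mat_diag (Suc n) (\<lambda>i. complex_of_real (g i)) * mat_adjoint V = A'" .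
  have "(W * V) * mat_diag (Suc n) (\<lambda>i. complex_of_real (g i)) * mat_adjoint (W * V) = A"
    using W V A by (subst conjugation_mult[of _ "Suc n"]) (auto simp: eq A'_def unitary_conjugation_inverse)
  then show ?case
    using W V uV unitary_mat_mult by (intro exI[of _ "W * V"] exI[of _ g]) auto
qed

section \<open>The Schur-Horn theorem\<close>

lemma exists_orthogonal_phase:
  fixes g :: complex
  shows "\<exists>u. u * cnj u = 1 \<and> Re (cnj u * g) = 0"
proof (cases "g = 0")
  case True
  then show ?thesis by (intro exI[of _ 1]) auto
next
  case False
  define u where "u = \<i> * g / complex_of_real (cmod g)"
  have "u * cnj u = (g * cnj g) / complex_of_real ((cmod g)\<^sup>2)"
    by (simp add: u_def power2_eq_square mult_ac)
  also have "\<dots> = 1" using False by (subst complex_norm_square) simp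
  finally have "u * cnj u = 1" .
  moreover have "cnj u * g = - (\<i> * ((g * cnj g) / complex_of_real (cmod g)))"
    by (simp add: u_def mult_ac)
  then have "Re (cnj u * g) = 0"
    by (simp add: complex_norm_square[symmetric] del: complex_cnj_mult)
  ultimately show ?thesis by blast
qed

lemma rotation_row_sum:
  fixes h :: "nat \<Rightarrow> complex"
  assumes "i < d" "j < d" "i \<noteq> j" "k < d"
  shows "(\<Sum>l<d. (if k = i then if l = i then a else if l = j then b else 0
               else if k = j then if l = i then c else if l = j then e else 0
               else if k = l then 1 else 0) * h l) =
    (if k = i then a * h i + b * h j else if k = j then c * h i + e * h j else h k)" (is "(\<Sum>l<d. ?z l * h l) = ?r")
proof (cases "k = i \<or> k = j")
  case True
  have "(\<Sum>l<d. ?z l * h l) = (\<Sum>l\<in>{i,j}. ?z l * h l)"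
    using assms True by (intro sum.mono_neutral_right) auto
  then show ?thesis using assms True by auto
next
  case False
  have "(\<Sum>l<d. ?z l * h l) = (\<Sum>l\<in>{k}. ?z l * h l)"
    using assms False by (intro sum.mono_neutral_right) auto
  then show ?thesis using assms False by auto
qed

text \<open>A rotation in the plane of coordinates \<open>i\<close> and \<open>j\<close> realizes a pinch of the diagonal. With
\<open>cos^2 = 1 - r\<close> and \<open>sin^2 = r\<close> the two diagonal entries become the required convex combinations up to
\<open>2 * cos * sin * Re (cnj u * G $$ (i, j))\<close>, which vanishes for a suitable phase \<open>u\<close> of the rotation.\<close>

lemma exists_pinching_unitary:
  assumes G: "G \<in> carrier_mat d d" "hermitian_mat G"
    and diag: "\<And>k. k < d \<Longrightarrow> G $$ (k, k) = complex_of_real (x k)"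
    and ij: "i < d" "j < d" "i \<noteq> j" and p: "x i \<le> p" "p \<le> x j"
  shows "\<exists>Z. Z \<in> carrier_mat d d \<and> unitary_mat Z \<and>
    (\<forall>k<d. (Z * G * mat_adjoint Z) $$ (k, k) = complex_of_real ((x(i := p, j := x i + x j - p)) k))"
proof -
  obtain r where r: "0 \<le> r" "r \<le> 1" "p = (1 - r) * x i + r * x j"
  proof (cases "x i = x j")
    case True
    then show ?thesis using p that[of 0] by simp
  next
    case False
    define r where "r = (p - x i) / (x j - x i)"
    have "r * (x j - x i) = p - x i" using False by (simp add: r_def)
    moreover have "0 \<le> r" "r \<le> 1" using p False by (auto simp: r_def divide_simps)
    ultimately show ?thesis using that[of r] by (simp add: algebra_simps)
  qed
  define c where "c = complex_of_real (sqrt (1 - r))"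
  define s where "s = complex_of_real (sqrt r)"
  have c2: "c * c = complex_of_real (1 - r)" and s2: "s * s = complex_of_real r"
    using r by (auto simp: c_def s_def of_real_mult[symmetric] simp del: of_real_mult)
  have cnj_cs: "cnj c = c" "cnj s = s" by (simp_all add: c_def s_def)
  obtain u where u: "u * cnj u = 1" "Re (cnj u * G $$ (i, j)) = 0"
    using exists_orthogonal_phase by blast
  have Gji: "G $$ (j, i) = cnj (G $$ (i, j))" by (rule hermitian_index_cnj[OF G(2,1) ij(1,2)])
  have cross: "cnj u * G $$ (i, j) + u * cnj (G $$ (i, j)) = 0"
    using u(2) by (simp add: complex_eq_iff algebra_simps)
  define Z where "Z = mat d d (\<lambda>(k, l).
    if k = i then if l = i then c else if l = j then s * u else 0
    else if k = j then if l = i then - (s * cnj u) else if l = j then c else 0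
    else if k = l then 1 else 0)"
  have Z: "Z \<in> carrier_mat d d" by (simp add: Z_def)
  have row: "(\<Sum>l<d. Z $$ (k, l) * h l) =
      (if k = i then c * h i + s * u * h j else if k = j then - (s * cnj u) * h i + c * h j else h k)"
    if k: "k < d" for k h
  proof -
    have "(\<Sum>l<d. Z $$ (k, l) * h l) = (\<Sum>l<d. (if k = i then if l = i then c else if l = j then s * u else 0
      else if k = j then if l = i then - (s * cnj u) else if l = j then c else 0
      else if k = l then 1 else 0) * h l)"
      using k by (intro sum.cong) (auto simp: Z_def)
    then show ?thesis by (simp only: rotation_row_sum[OF ij k])
  qed
  have row': "(\<Sum>l<d. h l * cnj (Z $$ (k, l))) =
      (if k = i then c * h i + s * cnj u * h j else if k = j then - (s * u) * h i + c * h j else h k)"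
    if k: "k < d" for k h
  proof -
    have "(\<Sum>l<d. h l * cnj (Z $$ (k, l))) = cnj (\<Sum>l<d. Z $$ (k, l) * cnj (h l))"
      by (simp add: mult.commute)
    then show ?thesis unfolding row[OF k] by (simp add: cnj_cs)
  qed
  have "Z * mat_adjoint Z = 1\<^sub>m d"
  proof (rule eq_matI)
    fix k m assume "k < dim_row (1\<^sub>m d :: complex mat)" "m < dim_col (1\<^sub>m d :: complex mat)"
    then have km: "k < d" "m < d" by auto
    have "(Z * mat_adjoint Z) $$ (k, m) = (\<Sum>l<d. Z $$ (k, l) * cnj (Z $$ (m, l)))"
      using Z km by (subst index_mult_mat_sum[of _ d d _ d]) auto
    also have "\<dots> = (if k = m then 1 else 0)"
    proof -
      have "c * c + s * u * (s * cnj u) = c * c + s * s * (u * cnj u)" by (simp add: mult_ac)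
      then have "c * c + s * u * (s * cnj u) = 1" by (simp add: u(1) c2 s2)
      moreover from this have "s * u * (s * cnj u) + c * c = 1" by (simp only: add.commute)
      ultimately show ?thesis
        unfolding row[OF km(1)] using km ij by (auto simp: Z_def cnj_cs mult_ac)
    qed
    finally show "(Z * mat_adjoint Z) $$ (k, m) = 1\<^sub>m d $$ (k, m)" using km by simp
  qed (use Z in auto)
  then have "unitary_mat (mat_adjoint Z)" using Z by (intro unitary_matI[of _ d]) auto
  then have uZ: "unitary_mat Z" using unitary_mat_adjoint[of "mat_adjoint Z" d] Z by simp
  have "(Z * G * mat_adjoint Z) $$ (k, k) = complex_of_real ((x(i := p, j := x i + x j - p)) k)"
    if k: "k < d" for k
  proof -
    let ?g = "G $$ (i, j)"
    have *: "(Z * G * mat_adjoint Z) $$ (k, k) =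
      (\<Sum>a<d. Z $$ (k, a) * (\<Sum>b<d. G $$ (a, b) * cnj (Z $$ (k, b))))"
      by (rule index_conjugation[OF Z G(1) k k])
    consider "k = i" | "k = j" | "k \<noteq> i" "k \<noteq> j" by blast
    then show ?thesis
    proof cases
      case 1
      have "(Z * G * mat_adjoint Z) $$ (k, k) =
        c * (c * x i + s * cnj u * ?g) + s * u * (c * cnj ?g + s * cnj u * x j)"
        using ij 1 unfolding * row'[OF k] row[OF k] by (simp add: diag Gji)
      also have "\<dots> = c * c * x i + s * s * (u * cnj u) * x j + c * s * (cnj u * ?g + u * cnj ?g)"
        by (simp add: algebra_simps)
      also have "\<dots> = complex_of_real p" unfolding cross by (simp add: c2 s2 u(1) r(3))
      finally show ?thesis using 1 ij by simp
    next
      case 2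
      have "(Z * G * mat_adjoint Z) $$ (k, k) =
        - (s * cnj u) * (- (s * u) * x i + c * ?g) + c * (- (s * u) * cnj ?g + c * x j)"
        using ij 2 unfolding * row'[OF k] row[OF k] by (simp add: diag Gji)
      also have "\<dots> = s * s * (u * cnj u) * x i + c * c * x j - c * s * (cnj u * ?g + u * cnj ?g)"
        by (simp add: algebra_simps)
      also have "\<dots> = complex_of_real (x i + x j - p)"
        unfolding cross by (simp add: c2 s2 u(1) r(3) algebra_simps)
      finally show ?thesis using 2 ij by simp
    next
      case 3
      then show ?thesis unfolding * row'[OF k] row[OF k] by (simp add: diag k)
    qed
  qed
  then show ?thesis using Z uZ by blast
qed

text \<open>The existence half of the Schur-Horn theorem. The diagonals of the unitary conjugates of a Hermitian
matrix form a pinch-closed set, so they include every vector majorized by one of them.\<close>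

theorem schur_horn:
  assumes G: "G \<in> carrier_mat d d" "hermitian_mat G"
    and diag: "\<And>k. k < d \<Longrightarrow> G $$ (k, k) = complex_of_real (x k)"
    and maj: "majorizes {..<d} x y"
  shows "\<exists>Q. Q \<in> carrier_mat d d \<and> unitary_mat Q \<and>
    (\<forall>k<d. (Q * G * mat_adjoint Q) $$ (k, k) = complex_of_real (y k))"
proof -
  define R where "R = {z :: nat \<Rightarrow> real. \<exists>Q. Q \<in> carrier_mat d d \<and> unitary_mat Q \<and>
    (\<forall>k<d. (Q * G * mat_adjoint Q) $$ (k, k) = complex_of_real (z k))}"
  have "pinch_closed {..<d} R"
    unfolding pinch_closed_def
  proof (intro ballI allI impI)
    fix z i j p assume z: "z \<in> R" and ij: "i \<in> {..<d}" "j \<in> {..<d}" "i \<noteq> j" and p: "z i \<le> p" "p \<le> z j"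
    from z obtain Q where Q: "Q \<in> carrier_mat d d" "unitary_mat Q"
      "\<And>k. k < d \<Longrightarrow> (Q * G * mat_adjoint Q) $$ (k, k) = complex_of_real (z k)"
      by (auto simp: R_def)
    obtain Z where Z: "Z \<in> carrier_mat d d" "unitary_mat Z"
      "\<forall>k<d. (Z * (Q * G * mat_adjoint Q) * mat_adjoint Z) $$ (k, k) =
        complex_of_real ((z(i := p, j := z i + z j - p)) k)"
      using exists_pinching_unitary[OF _ hermitian_conjugation[OF Q(1) G] Q(3) _ _ ij(3) p]
        Q(1) G(1) ij(1,2) by (metis lessThan_iff mat_adjoint_carrier mult_carrier_mat)
    then have "\<forall>k<d. ((Z * Q) * G * mat_adjoint (Z * Q)) $$ (k, k) =
        complex_of_real ((z(i := p, j := z i + z j - p)) k)"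
      by (simp only: conjugation_mult[OF Z(1) Q(1) G(1)])
    moreover have "Z * Q \<in> carrier_mat d d" "unitary_mat (Z * Q)"
      using Z(1,2) Q(1,2) unitary_mat_mult by auto
    ultimately show "z(i := p, j := z i + z j - p) \<in> R"
      unfolding R_def by blast
  qed
  moreover have "unitary_mat (1\<^sub>m d)" by (rule unitary_matI[of _ d]) auto
  then have "x \<in> R" unfolding R_def using G diag by (intro CollectI exI[of _ "1\<^sub>m d"]) auto
  ultimately obtain z where "z \<in> R" "\<forall>j\<in>{..<d}. z j = y j"
    using pinch_closed_reaches_majorized[OF _ maj] by blast
  then show ?thesis by (auto simp: R_def)
qed

section \<open>Averages of unitary conjugates\<close>

lemma finsum_mat_carrier:
  fixes M :: "'b \<Rightarrow> complex mat"
  assumes "\<And>k. k \<in> I \<Longrightarrow> M k \<in> carrier_mat n m"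
  shows "(\<Oplus>\<^bsub>module_mat TYPE(complex) n m\<^esub> k\<in>I. M k) \<in> carrier_mat n m"
proof -
  interpret abelian_group "module_mat TYPE(complex) n m" by (rule abelian_group_mat)
  show ?thesis using finsum_closed[of M I] assms by (auto simp: module_mat_simps)
qed

lemma index_finsum_mat:
  fixes M :: "'b \<Rightarrow> complex mat"
  assumes "finite I" "\<And>k. k \<in> I \<Longrightarrow> M k \<in> carrier_mat n m" "i < n" "j < m"
  shows "(\<Oplus>\<^bsub>module_mat TYPE(complex) n m\<^esub> k\<in>I. M k) $$ (i, j) = (\<Sum>k\<in>I. M k $$ (i, j))"
  using assms(1,2)
proof (induction I rule: finite_induct)
  case empty
  interpret abelian_group "module_mat TYPE(complex) n m" by (rule abelian_group_mat)
  show ?case using assms(3,4) by (simp add: module_mat_simps)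
next
  case (insert k I)
  interpret abelian_group "module_mat TYPE(complex) n m" by (rule abelian_group_mat)
  have "(\<Oplus>\<^bsub>module_mat TYPE(complex) n m\<^esub> k\<in>I. M k) \<in> carrier_mat n m"
    using insert.prems by (intro finsum_mat_carrier) auto
  moreover have "(\<Oplus>\<^bsub>module_mat TYPE(complex) n m\<^esub> k\<in>insert k I. M k) =
      M k + (\<Oplus>\<^bsub>module_mat TYPE(complex) n m\<^esub> k\<in>I. M k)"
    using insert by (subst finsum_insert) (auto simp: module_mat_simps)
  ultimately show ?case using insert assms(3,4) by auto
qed

text \<open>A geometric sum: the ratio of two distinct \<open>d\<close>-th roots of unity is again a \<open>d\<close>-th root of unity,
and it differs from one.\<close>

lemma sum_roots_of_unity_orthogonal:
  assumes "a < d" "b < d"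
  shows "(\<Sum>k\<in>{1..d}. cis (2 * pi * real a / real d) ^ k * cnj (cis (2 * pi * real b / real d) ^ k)) =
    (if a = b then of_nat d else 0)"
proof -
  let ?w = "\<lambda>a. cis (2 * pi * real a / real d)"
  have d: "d > 0" using assms by simp
  have bij: "bij_betw ?w {..<d} {z. z ^ d = 1}" using bij_betw_roots_unity[OF d] by simp
  then have pow: "?w a ^ d = 1" if "a < d" for a using that by (auto dest: bij_betwE)
  have unit: "?w b * cnj (?w b) = 1" by (simp add: cis_cnj cis_mult)
  define z where "z = ?w a * cnj (?w b)"
  have terms: "?w a ^ k * cnj (?w b ^ k) = z ^ k" for k
    by (simp add: z_def power_mult_distrib)
  show ?thesis
  proof (cases "a = b")
    case True
    then show ?thesis using unit unfolding terms z_def by simp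
  next
    case False
    then have "?w a \<noteq> ?w b" using bij assms unfolding bij_betw_def inj_on_def by blast
    moreover have "z * ?w b = ?w a" using unit by (simp add: z_def mult.assoc mult.commute[of "cnj _"])
    ultimately have z1: "z \<noteq> 1" by auto
    have "z ^ d = ?w a ^ d * cnj (?w b ^ d)" by (rule terms[symmetric])
    then have zd: "z ^ d = 1" using pow assms by simp
    have "(\<Sum>k\<in>{1..d}. z ^ k) = z * (\<Sum>k<d. z ^ k)"
      unfolding sum_distrib_left by (intro sum.reindex_bij_witness[of _ Suc "\<lambda>k. k - 1"]) (auto simp flip: power_Suc)
    also have "\<dots> = 0" using z1 zd by (simp add: geometric_sum)
    finally show ?thesis using False by (simp only: terms) simp
  qed
qed

text \<open>By Schur-Horn a conjugate \<open>G\<close> of \<open>S\<close> has the eigenvalues of \<open>T\<close> on its diagonal. Averaging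
\<open>F * G * F^*\<close> over the \<open>d\<close> powers \<open>F\<close> of the diagonal matrix of the \<open>d\<close>-th roots of unity erases the off-diagonal
entries, since the \<open>(a, b)\<close> entry is multiplied by a sum of powers of \<open>w a * cnj (w b)\<close>. The average is thus the diagonal
matrix of eigenvalues of \<open>T\<close>, and conjugation by the diagonalizing matrix \<open>V\<close> turns it into \<open>T\<close>.\<close>

theorem majorized_is_unitary_average:
  assumes d: "d > 0"
    and S: "S \<in> carrier_mat d d" and W: "W \<in> carrier_mat d d" "unitary_mat W"
    and Seq: "S = W * mat_diag d (\<lambda>i. complex_of_real (x i)) * mat_adjoint W"
    and V: "V \<in> carrier_mat d d" "unitary_mat V"
    and Teq: "T = V * mat_diag d (\<lambda>i. complex_of_real (y i)) * mat_adjoint V"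
    and maj: "majorizes {..<d} x y"
  shows "\<exists>U. (\<forall>k\<in>{1..d}. U k \<in> carrier_mat d d \<and> unitary_mat (U k)) \<and>
    T = (1 / of_nat d) \<cdot>\<^sub>m (\<Oplus>\<^bsub>module_mat TYPE(complex) d d\<^esub> k\<in>{1..d}. U k * S * mat_adjoint (U k))"
proof -
  define D where "D = mat_diag d (\<lambda>i. complex_of_real (x i))"
  have D: "D \<in> carrier_mat d d" by (simp add: D_def)
  have hD: "hermitian_mat D"
    unfolding hermitian_mat_def D_def by (rule eq_matI) (auto simp: mat_diag_def)
  obtain Q where Q: "Q \<in> carrier_mat d d" "unitary_mat Q"
    and Qdiag: "\<And>k. k < d \<Longrightarrow> (Q * D * mat_adjoint Q) $$ (k, k) = complex_of_real (y k)"
    using schur_horn[OF D hD _ maj] by (auto simp: D_def mat_diag_def)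
  define G where "G = Q * D * mat_adjoint Q"
  have G: "G \<in> carrier_mat d d" using Q D by (simp add: G_def)
  define w where "w a = cis (2 * pi * real a / real d)" for a
  define F where "F k = mat_diag d (\<lambda>i. w i ^ k)" for k :: nat
  have F: "F k \<in> carrier_mat d d" for k by (simp add: F_def)
  have adjF: "mat_adjoint (F k) = mat_diag d (\<lambda>i. cnj (w i ^ k))" for k
    unfolding F_def by (rule eq_matI) (auto simp: mat_diag_def)
  have uF: "unitary_mat (F k)" for k
    by (rule unitary_matI[OF F], unfold adjF, unfold F_def)
       (simp add: w_def flip: power_mult_distrib, simp add: cis_cnj cis_mult)
  define U where "U k = V * F k * Q * mat_adjoint W" for k
  have U: "U k \<in> carrier_mat d d" for k using V F Q W by (simp add: U_def)
  have uU: "unitary_mat (U k)" for k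
    unfolding U_def using V F uF Q W
    by (intro unitary_mat_mult[of _ d] unitary_mat_adjoint[of _ d]) auto
  have "mat_adjoint W * S * W = D"
    using unitary_conjugation_inverse[of "mat_adjoint W" d D] W D unitary_mat_adjoint[OF W]
    by (simp add: Seq D_def)
  moreover have "U k * S * mat_adjoint (U k) =
      V * (F k * (Q * (mat_adjoint W * S * W) * mat_adjoint Q) * mat_adjoint (F k)) * mat_adjoint V" for k
    unfolding U_def using V F[of k] Q W S
    by (simp add: mat_adjoint_mult[of _ d d _ d] assoc_mult_mat[of _ d d _ d _ d])
  ultimately have conj: "U k * S * mat_adjoint (U k) = V * (F k * G * mat_adjoint (F k)) * mat_adjoint V" for k
    by (simp add: G_def)
  have FG: "(F k * G * mat_adjoint (F k)) $$ (a, b) = w a ^ k * cnj (w b ^ k) * G $$ (a, b)"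
    if "a < d" "b < d" for a b k
    unfolding adjF using that G F[of k]
    by (simp add: mat_diag_mult_right[of _ d] F_def mat_diag_mult_left[of _ d d] mult_ac)
  have sumFG: "(\<Sum>k\<in>{1..d}. (F k * G * mat_adjoint (F k)) $$ (a, b)) =
      of_nat d * mat_diag d (\<lambda>i. complex_of_real (y i)) $$ (a, b)" if ab: "a < d" "b < d" for a b
  proof -
    have "(\<Sum>k\<in>{1..d}. (F k * G * mat_adjoint (F k)) $$ (a, b)) =
        (\<Sum>k\<in>{1..d}. w a ^ k * cnj (w b ^ k)) * G $$ (a, b)"
      unfolding sum_distrib_right by (intro sum.cong refl) (simp add: FG ab)
    then show ?thesis
      unfolding w_def sum_roots_of_unity_orthogonal[OF ab]
      using ab Qdiag by (auto simp: mat_diag_def G_def)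
  qed
  have "T = (1 / of_nat d) \<cdot>\<^sub>m (\<Oplus>\<^bsub>module_mat TYPE(complex) d d\<^esub> k\<in>{1..d}. U k * S * mat_adjoint (U k))"
    (is "T = _ \<cdot>\<^sub>m ?sum")
  proof (rule eq_matI)
    have carr: "U k * S * mat_adjoint (U k) \<in> carrier_mat d d" for k using U S by simp
    have sum: "?sum \<in> carrier_mat d d"
      using carr by (intro finsum_mat_carrier)
    have T: "T \<in> carrier_mat d d" using V by (simp add: Teq)
    show "dim_row T = dim_row ((1 / of_nat d) \<cdot>\<^sub>m ?sum)" "dim_col T = dim_col ((1 / of_nat d) \<cdot>\<^sub>m ?sum)"
      using sum T by auto
    fix i j assume "i < dim_row ((1 / of_nat d) \<cdot>\<^sub>m ?sum)" "j < dim_col ((1 / of_nat d) \<cdot>\<^sub>m ?sum)"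
    then have ij: "i < d" "j < d" using sum by auto
    have "?sum $$ (i, j) = (\<Sum>k\<in>{1..d}. (U k * S * mat_adjoint (U k)) $$ (i, j))"
      by (rule index_finsum_mat) (use carr ij in auto)
    also have "\<dots> = (\<Sum>k\<in>{1..d}. \<Sum>a<d. \<Sum>b<d. V $$ (i, a) * cnj (V $$ (j, b)) * (F k * G * mat_adjoint (F k)) $$ (a, b))"
      unfolding conj using V F G ij
      by (intro sum.cong refl, subst index_conjugation[of _ d d]) (auto simp: sum_distrib_left mult_ac intro!: sum.cong)
    also have "\<dots> = (\<Sum>a<d. \<Sum>b<d. V $$ (i, a) * cnj (V $$ (j, b)) * (\<Sum>k\<in>{1..d}. (F k * G * mat_adjoint (F k)) $$ (a, b)))"
      unfolding sum_distrib_left by (rule trans[OF sum.swap], rule sum.cong[OF refl], rule sum.swap)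
    also have "\<dots> = (\<Sum>a<d. \<Sum>b<d. V $$ (i, a) * cnj (V $$ (j, b)) * (of_nat d * mat_diag d (\<lambda>i. complex_of_real (y i)) $$ (a, b)))"
      by (intro sum.cong refl) (simp only: sumFG lessThan_iff)
    also have "\<dots> = of_nat d * T $$ (i, j)"
      unfolding Teq using V ij
      by (subst index_conjugation[of _ d d]) (auto simp: sum_distrib_left mult_ac intro!: sum.cong)
    finally have "?sum $$ (i, j) = of_nat d * T $$ (i, j)" .
    then show "T $$ (i, j) = ((1 / of_nat d) \<cdot>\<^sub>m ?sum) $$ (i, j)"
      using sum ij d by simp
  qed
  then show ?thesis using U uU by (intro exI[of _ U]) simp
qed

section \<open>Spectra under unital trace-preserving maps\<close>

lemma hermitian_add:
  assumes "A \<in> carrier_mat n n" "B \<in> carrier_mat n n" "hermitian_mat A" "hermitian_mat B"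
  shows "hermitian_mat (A + B)"
  using assms by (simp add: hermitian_mat_def mat_adjoint_add[of _ n n])

lemma conjugation_add:
  fixes U A B :: "complex mat"
  assumes "U \<in> carrier_mat n n" "A \<in> carrier_mat n n" "B \<in> carrier_mat n n"
  shows "mat_adjoint U * (A + B) * U = mat_adjoint U * A * U + mat_adjoint U * B * U"
  using assms by (simp add: mult_add_distrib_mat[of _ n n _ n] add_mult_distrib_mat[of _ n n _ _ n])

lemma index_gram_diagonal:
  fixes M :: "complex mat"
  assumes "M \<in> carrier_mat n n" "i < n"
  shows "(mat_adjoint M * M) $$ (i, i) = complex_of_real (\<Sum>a<n. (cmod (M $$ (a, i)))\<^sup>2)"
    and "(M * mat_adjoint M) $$ (i, i) = complex_of_real (\<Sum>a<n. (cmod (M $$ (i, a)))\<^sup>2)"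
proof -
  show "(mat_adjoint M * M) $$ (i, i) = complex_of_real (\<Sum>a<n. (cmod (M $$ (a, i)))\<^sup>2)"
    unfolding of_real_sum complex_norm_square using assms
    by (subst index_mult_mat_sum[of _ n n _ n]) (auto simp: mult.commute intro!: sum.cong)
  show "(M * mat_adjoint M) $$ (i, i) = complex_of_real (\<Sum>a<n. (cmod (M $$ (i, a)))\<^sup>2)"
    unfolding of_real_sum complex_norm_square using assms
    by (subst index_mult_mat_sum[of _ n n _ n]) (auto intro!: sum.cong)
qed

text \<open>In eigenbases \<open>W\<close> of \<open>S\<close> and \<open>V\<close> of its image, each eigenvalue of the image is a combination
of the eigenvalues of \<open>S\<close> with weights the squared moduli of the entries of \<open>W^* K V\<close> and \<open>W^* L V\<close>. The first
normalization of \<open>K\<close> and \<open>L\<close> makes the weights for each eigenvalue of the image add up to one, and the second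
does so for the weights of each eigenvalue of \<open>S\<close>; the weights form a doubly stochastic matrix.\<close>

lemma two_term_channel_majorizes:
  assumes K: "K \<in> carrier_mat d d" and L: "L \<in> carrier_mat d d"
    and unital: "mat_adjoint K * K + mat_adjoint L * L = 1\<^sub>m d"
    and trace: "K * mat_adjoint K + L * mat_adjoint L = 1\<^sub>m d"
    and W: "W \<in> carrier_mat d d" "unitary_mat W"
    and V: "V \<in> carrier_mat d d" "unitary_mat V"
    and S: "S = W * mat_diag d (\<lambda>i. complex_of_real (x i)) * mat_adjoint W"
    and T: "mat_adjoint K * S * K + mat_adjoint L * S * L =
      V * mat_diag d (\<lambda>i. complex_of_real (y i)) * mat_adjoint V"
  shows "majorizes {..<d} x y"
proof -
  define D where "D = mat_diag d (\<lambda>i. complex_of_real (x i))"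
  have D: "D \<in> carrier_mat d d" by (simp add: D_def)
  define M where "M H = mat_adjoint W * H * V" for H
  have M: "M H \<in> carrier_mat d d" if "H \<in> carrier_mat d d" for H using that W V by (simp add: M_def)
  note assoc = assoc_mult_mat[of _ d d _ d _ d] and adj = mat_adjoint_mult[of _ d d _ d]
  have cancel: "U * (mat_adjoint U * H) = H" "mat_adjoint U * (U * H) = H"
    if "U \<in> carrier_mat d d" "unitary_mat U" "H \<in> carrier_mat d d" for U H
    using that unitary_matD[OF that(1,2)] by (simp_all add: assoc[symmetric])
  have rows: "mat_adjoint (M H) * M H = mat_adjoint V * (mat_adjoint H * H) * V"
    and cols: "M H * mat_adjoint (M H) = mat_adjoint W * (H * mat_adjoint H) * W"
    and vals: "mat_adjoint (M H) * D * M H = mat_adjoint V * (mat_adjoint H * S * H) * V"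
    if "H \<in> carrier_mat d d" for H
    using that W V D by (simp_all add: M_def adj assoc cancel S D_def[symmetric])
  define P where "P i j = (cmod (M K $$ (j, i)))\<^sup>2 + (cmod (M L $$ (j, i)))\<^sup>2" for i j
  have row_sum: "(\<Sum>j<d. P i j) = 1" if i: "i < d" for i
  proof -
    have "mat_adjoint (M K) * M K + mat_adjoint (M L) * M L = 1\<^sub>m d"
      using conjugation_add[OF V(1), of "mat_adjoint K * K" "mat_adjoint L * L"] K L V
      by (simp add: rows unital unitary_matD)
    then have "(mat_adjoint (M K) * M K + mat_adjoint (M L) * M L) $$ (i, i) = 1" using i by simp
    then have "(mat_adjoint (M K) * M K) $$ (i, i) + (mat_adjoint (M L) * M L) $$ (i, i) = 1"
      using i M[OF K] M[OF L] by (subst (asm) index_add_mat) auto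
    then have "complex_of_real (\<Sum>j<d. P i j) = 1"
      unfolding index_gram_diagonal(1)[OF M[OF K] i] index_gram_diagonal(1)[OF M[OF L] i]
      by (simp add: P_def sum.distrib)
    then show ?thesis by (simp only: of_real_eq_1_iff)
  qed
  have col_sum: "(\<Sum>i<d. P i j) = 1" if j: "j < d" for j
  proof -
    have "M K * mat_adjoint (M K) + M L * mat_adjoint (M L) = 1\<^sub>m d"
      using conjugation_add[OF W(1), of "K * mat_adjoint K" "L * mat_adjoint L"] K L W
      by (simp add: cols trace unitary_matD)
    then have "(M K * mat_adjoint (M K) + M L * mat_adjoint (M L)) $$ (j, j) = 1" using j by simp
    then have "(M K * mat_adjoint (M K)) $$ (j, j) + (M L * mat_adjoint (M L)) $$ (j, j) = 1"
      using j M[OF K] M[OF L] by (subst (asm) index_add_mat) auto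
    then have "complex_of_real (\<Sum>i<d. P i j) = 1"
      unfolding index_gram_diagonal(2)[OF M[OF K] j] index_gram_diagonal(2)[OF M[OF L] j]
      by (simp add: P_def sum.distrib)
    then show ?thesis by (simp only: of_real_eq_1_iff)
  qed
  have diag: "(mat_adjoint (M H) * D * M H) $$ (i, i) =
      complex_of_real (\<Sum>j<d. (cmod (M H $$ (j, i)))\<^sup>2 * x j)"
    if H: "H \<in> carrier_mat d d" and i: "i < d" for H i
  proof -
    have "(mat_adjoint (M H) * D * M H) $$ (i, i) =
        (\<Sum>a<d. mat_adjoint (M H) $$ (i, a) * (\<Sum>b<d. D $$ (a, b) * cnj (mat_adjoint (M H) $$ (i, b))))"
      using index_conjugation[of "mat_adjoint (M H)" d d D i i] M[OF H] D i by simp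
    also have "\<dots> = (\<Sum>a<d. cnj (M H $$ (a, i)) * (complex_of_real (x a) * M H $$ (a, i)))"
    proof (intro sum.cong refl arg_cong2[where f = "(*)"])
      fix a assume "a \<in> {..<d}"
      then have a: "a < d" by simp
      show "mat_adjoint (M H) $$ (i, a) = cnj (M H $$ (a, i))" using M[OF H] a i by simp
      have "(\<Sum>b<d. D $$ (a, b) * cnj (mat_adjoint (M H) $$ (i, b))) =
          (\<Sum>b<d. if a = b then complex_of_real (x b) * M H $$ (b, i) else 0)"
        using M[OF H] a i by (intro sum.cong) (auto simp: D_def mat_diag_def)
      then show "(\<Sum>b<d. D $$ (a, b) * cnj (mat_adjoint (M H) $$ (i, b))) = complex_of_real (x a) * M H $$ (a, i)"
        using a by simp
    qed
    finally show ?thesis by (simp only: of_real_sum of_real_mult complex_norm_square mult_ac)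
  qed
  have "y i = (\<Sum>j<d. P i j * x j)" if i: "i < d" for i
  proof -
    have SC: "S \<in> carrier_mat d d" using W by (simp add: S)
    have "mat_adjoint (M K) * D * M K + mat_adjoint (M L) * D * M L =
        mat_adjoint V * (mat_adjoint K * S * K + mat_adjoint L * S * L) * V"
      using K L SC by (simp add: vals conjugation_add[OF V(1)])
    also have "\<dots> = mat_diag d (\<lambda>i. complex_of_real (y i))"
      unfolding T using V by (simp add: assoc cancel unitary_matD right_mult_one_mat[of _ d d])
    finally have "(mat_adjoint (M K) * D * M K + mat_adjoint (M L) * D * M L) $$ (i, i) = complex_of_real (y i)"
      using i by (simp add: mat_diag_def)
    then have "(mat_adjoint (M K) * D * M K) $$ (i, i) + (mat_adjoint (M L) * D * M L) $$ (i, i) = complex_of_real (y i)"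
      using i M[OF K] M[OF L] D by (subst (asm) index_add_mat) auto
    then have "complex_of_real (\<Sum>j<d. P i j * x j) = complex_of_real (y i)"
      unfolding diag[OF K i] diag[OF L i] by (simp add: P_def sum.distrib distrib_right)
    then show ?thesis by (simp only: of_real_eq_iff)
  qed
  then show ?thesis
    using row_sum col_sum by (intro doubly_stochastic_majorizes[of _ P]) (auto simp: P_def)
qed

section \<open>The direct sum as an average over a unitary orbit\<close>

lemma diag_block_mat_pair:
  "diag_block_mat [A, B] = four_block_mat A (0\<^sub>m (dim_row A) (dim_col B)) (0\<^sub>m (dim_row B) (dim_col A)) B"
  by (simp only: diag_block_mat.simps(2)[of A "[B]"] diag_block_mat_singleton Let_def)

theorem theorem3p2:
  fixes n :: nat and A B X Y :: "complex mat"
  assumes "n \<ge> 1"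
    and "A \<in> carrier_mat n n" "B \<in> carrier_mat n n"
    and "X \<in> carrier_mat n n" "Y \<in> carrier_mat n n"
    and "hermitian_mat A" "hermitian_mat B"
    and "mat_adjoint X * X + mat_adjoint Y * Y = 1\<^sub>m n"
    and "X * mat_adjoint X + Y * mat_adjoint Y = 1\<^sub>m n"
  shows "\<exists>U :: nat \<Rightarrow> complex mat.
    (\<forall>k\<in>{1..2*n}. U k \<in> carrier_mat (2*n) (2*n) \<and> unitary_mat (U k)) \<and>
    diag_block_mat
      [mat_adjoint X * A * X + mat_adjoint Y * B * Y,
       mat_adjoint Y * A * Y + mat_adjoint X * B * X] =
    (1 / of_nat (2*n) :: complex) \<cdot>\<^sub>m
      (\<Oplus>\<^bsub>module_mat TYPE(complex) (2*n) (2*n)\<^esub> k\<in>{1..2*n}.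
         U k * diag_block_mat [A, B] * mat_adjoint (U k))"
proof -
  note A = assms(2) and B = assms(3) and X = assms(4) and Y = assms(5)
  let ?O = "0\<^sub>m n n :: complex mat"
  \<comment> \<open>The diagonal blocks \<open>X\<close> produce the terms \<open>X^* A X\<close> and \<open>X^* B X\<close>; the off-diagonal blocks \<open>Y\<close>
    exchange the summands and produce \<open>Y^* B Y\<close> and \<open>Y^* A Y\<close>.\<close>
  define S where "S = four_block_mat A ?O ?O B"
  define K where "K = four_block_mat X ?O ?O X"
  define L where "L = four_block_mat ?O Y Y ?O"
  have block: "four_block_mat E F G H \<in> carrier_mat (2 * n) (2 * n)"
    if "E \<in> carrier_mat n n" "H \<in> carrier_mat n n" for E F G H :: "complex mat"
    using four_block_carrier_mat[OF that] by (simp add: mult_2)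
  have S: "S \<in> carrier_mat (2 * n) (2 * n)" and K: "K \<in> carrier_mat (2 * n) (2 * n)"
    and L: "L \<in> carrier_mat (2 * n) (2 * n)"
    unfolding S_def K_def L_def using A B X by (auto intro!: block)
  note adj = mat_adjoint_four_block[of _ n n _ n _ n] and mult = mult_four_block_mat[of _ n n _ n _ n _ _ n _ n]
    and add = add_four_block_mat[of _ n n _ n _ n]
  have adjS: "mat_adjoint S = S" and adjK: "mat_adjoint K = four_block_mat (mat_adjoint X) ?O ?O (mat_adjoint X)"
    and adjL: "mat_adjoint L = four_block_mat ?O (mat_adjoint Y) (mat_adjoint Y) ?O"
    using assms by (simp_all add: S_def K_def L_def adj hermitian_mat_def)
  have one: "four_block_mat (1\<^sub>m n) ?O ?O (1\<^sub>m n) = (1\<^sub>m (n + n) :: complex mat)"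
    by (rule eq_matI) auto
  have unital: "mat_adjoint K * K + mat_adjoint L * L = 1\<^sub>m (2 * n)"
    unfolding adjK adjL unfolding K_def L_def using X Y assms(8)
    by (simp add: mult add one mult_2)
  have trace: "K * mat_adjoint K + L * mat_adjoint L = 1\<^sub>m (2 * n)"
    unfolding adjK adjL unfolding K_def L_def using X Y assms(9)
    by (simp add: mult add one mult_2)
  define T where "T = mat_adjoint K * S * K + mat_adjoint L * S * L"
  have "T = four_block_mat (mat_adjoint X * A * X + mat_adjoint Y * B * Y) ?O ?O
      (mat_adjoint X * B * X + mat_adjoint Y * A * Y)"
    unfolding T_def adjK adjL unfolding K_def L_def S_def using A B X Y
    by (simp add: mult add)
  also have "mat_adjoint X * B * X + mat_adjoint Y * A * Y = mat_adjoint Y * A * Y + mat_adjoint X * B * X"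
    using A B X Y by (intro comm_add_mat[of _ n n]) auto
  finally have T_block: "T = diag_block_mat
      [mat_adjoint X * A * X + mat_adjoint Y * B * Y, mat_adjoint Y * A * Y + mat_adjoint X * B * X]"
    unfolding diag_block_mat_pair using A B X Y by simp
  have S_block: "S = diag_block_mat [A, B]"
    unfolding diag_block_mat_pair S_def using A B by simp
  have hS: "hermitian_mat S" using adjS by (simp add: hermitian_mat_def)
  have T: "T \<in> carrier_mat (2 * n) (2 * n)" using S K L by (simp add: T_def)
  have hT: "hermitian_mat T"
    unfolding T_def
    using hermitian_conjugation[of "mat_adjoint K" "2 * n" S] hermitian_conjugation[of "mat_adjoint L" "2 * n" S]
      S K L hS by (intro hermitian_add[of _ "2 * n"]) auto
  obtain W x where W: "W \<in> carrier_mat (2 * n) (2 * n)" "unitary_mat W"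
    and Seq: "S = W * mat_diag (2 * n) (\<lambda>i. complex_of_real (x i)) * mat_adjoint W"
    using hermitian_diagonalization[OF S hS] by blast
  obtain V y where V: "V \<in> carrier_mat (2 * n) (2 * n)" "unitary_mat V"
    and Teq: "T = V * mat_diag (2 * n) (\<lambda>i. complex_of_real (y i)) * mat_adjoint V"
    using hermitian_diagonalization[OF T hT] by blast
  have "majorizes {..<2 * n} x y"
    by (rule two_term_channel_majorizes[OF K L unital trace W V Seq Teq[unfolded T_def]])
  moreover have "2 * n > 0" using assms(1) by simp
  ultimately show ?thesis
    using majorized_is_unitary_average[OF _ S W Seq V Teq] unfolding S_block T_block by blast
qed

end
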